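(* Let $L\in\mathbb{N}$, $\Omega=\{1,\dots,L\}$, let $F\in\mathbb{R}^{L\times L}$ be an irreducible stochastic matrix, and let $X$ be a Markov chain on $\Omega$ with transition matrix $F$. For all $i,j\in\Omega$ with $i\ne j$, $$\frac12\,\frac{1}{\mathbf{P}_i[\tau_j<\tau_i]}\ \le\ \max_{m\in\Omega}\left|\frac{\partial\log\pi_m}{\partial F_{ij}}(F)\right|\ \le\ \frac{1}{\mathbf{P}_i[\tau_j<\tau_i]},$$ and $$\max_{m\in\Omega}\frac{\partial\log\pi_m}{\partial F_{ij}}(F)-\min_{m\in\Omega}\frac{\partial\log\pi_m}{\partial F_{ij}}(F)=\frac{1}{\mathbf{P}_i[\tau_j<\tau_i]}.$$
   Context: A matrix is stochastic if its entries are nonnegative and every row sums to $1$. For an irreducible stochastic matrix $G$, $\pi(G)\in\mathbb{R}^L$ is the invariant distribution: the unique vector with $\pi(G)^{\mathrm t}G=\pi(G)^{\mathrm t}$ and $\pi(G)^{\mathrm t}e=1$, where $e$ is the vector of ones; its entries are positive. $e_i$ denotes the $i$th standard basis vector of $\mathbb{R}^L$. Partial derivatives: the function $\pi$ admits a continuously differentiable extension $\bar\pi:\mathcal V\to\mathbb{R}^L$ to an open neighborhood $\mathcal V\subset\mathbb{R}^{L\times L}$ of the set of irreducible stochastic matrices, such that $\bar\pi(G)>0$ entrywise for all $G\in\mathcal V$ and such that, whenever $G\in\mathcal V$ and $Ge=e$, one has $\bar\pi(G)^{\mathrm t}G=\bar\pi(G)^{\mathrm t}$ and $\bar\pi(G)^{\mathrm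 t}e=1$. Fix any such extension (the quantities below do not depend on the choice). For $i\ne j$, $$\frac{\partial\pi_m}{\partial F_{ij}}(F):=\left.\frac{d}{d\varepsilon}\right|_{\varepsilon=0}\bar\pi_m\left(F+\varepsilon(e_ie_j^{\mathrm t}-e_ie_i^{\mathrm t})\right),\qquad \frac{\partial\log\pi_m}{\partial F_{ij}}(F):=\frac{1}{\pi_m(F)}\frac{\partial\pi_m}{\partial F_{ij}}(F).$$ Hitting times: $\tau_k:=\min\{s>0:X_s=k\}$ for $k\in\Omega$, and $\mathbf{P}_i[A]:=\mathbf{P}[A\mid X_0=i]$. *)

theory Defs
  imports "HOL-Probability.Probability"
begin

section \<open>Stochastic matrices and their invariant distributions\<close>

definition stochastic_matrix :: "real^'n^'n \<Rightarrow> bool" where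
  "stochastic_matrix G \<longleftrightarrow> (\<forall>i j. 0 \<le> G $ i $ j) \<and> (\<forall>i. (\<Sum>j\<in>UNIV. G $ i $ j) = 1)"

text \<open>The matrix power \<open>G\<^sup>k\<close> is the \<open>k\<close>-fold iterate of left multiplication by \<open>G\<close>,
  applied to the identity matrix.\<close>

definition irreducible_matrix :: "real^'n^'n \<Rightarrow> bool" where
  "irreducible_matrix G \<longleftrightarrow> (\<forall>i j. \<exists>k. 0 < ((\<lambda>A. G ** A) ^^ k) (mat 1) $ i $ j)"

definition invariant_distribution :: "real^'n^'n \<Rightarrow> real^'n" where
  "invariant_distribution G = (THE p. p v* G = p \<and> p \<bullet> 1 = 1)"

section \<open>Derivatives of the invariant distribution\<close>

definition continuously_differentiable_on ::
    "('a::real_normed_vector \<Rightarrow> 'b::real_normed_vector) \<Rightarrow> 'a set \<Rightarrow> bool" where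
  "continuously_differentiable_on f V \<longleftrightarrow>
     (\<exists>D :: 'a \<Rightarrow> 'a \<Rightarrow>\<^sub>L 'b. (\<forall>x\<in>V. (f has_derivative blinfun_apply (D x)) (at x)) \<and> continuous_on V D)"

text \<open>Admissible extensions \<open>p\<close> of the invariant distribution to a neighbourhood \<open>V\<close> of the
  irreducible stochastic matrices; only the values of \<open>p\<close> on \<open>V\<close> are constrained.\<close>

definition invariant_extension :: "(real^'n^'n) set \<Rightarrow> (real^'n^'n \<Rightarrow> real^'n) \<Rightarrow> bool" where
  "invariant_extension V p \<longleftrightarrow>
     open V \<and> {G. stochastic_matrix G \<and> irreducible_matrix G} \<subseteq> V \<and>
     continuously_differentiable_on p V \<and>
     (\<forall>G. stochastic_matrix G \<and> irreducible_matrix G \<longrightarrow> p G = invariant_distribution G) \<and>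
     (\<forall>G\<in>V. \<forall>m. 0 < p G $ m) \<and>
     (\<forall>G\<in>V. G *v 1 = 1 \<longrightarrow> p G v* G = p G \<and> p G \<bullet> 1 = 1)"

definition outer_product :: "real^'n \<Rightarrow> real^'n \<Rightarrow> real^'n^'n" where
  "outer_product u v = (\<chi> a b. u $ a * v $ b)"

definition partial_pi :: "(real^'n^'n \<Rightarrow> real^'n) \<Rightarrow> real^'n^'n \<Rightarrow> 'n \<Rightarrow> 'n \<Rightarrow> 'n \<Rightarrow> real" where
  "partial_pi p F i j m =
     deriv (\<lambda>\<epsilon>::real. p (F + \<epsilon> *\<^sub>R (outer_product (axis i 1) (axis j 1)
                                   - outer_product (axis i 1) (axis i 1))) $ m) 0"

definition partial_log_pi :: "(real^'n^'n \<Rightarrow> real^'n) \<Rightarrow> real^'n^'n \<Rightarrow> 'n \<Rightarrow> 'n \<Rightarrow> 'n \<Rightarrow> real" where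
  "partial_log_pi p F i j m = 1 / invariant_distribution F $ m * partial_pi p F i j m"

section \<open>Markov chains and hitting times\<close>

text \<open>The initial distribution is arbitrary. The guard is needed because \<open>cond_prob\<close> is \<open>0\<close>
  when the conditioning event is null.\<close>

definition markov_chain :: "'a measure \<Rightarrow> (nat \<Rightarrow> 'a \<Rightarrow> 'n::finite) \<Rightarrow> real^'n^'n \<Rightarrow> bool" where
  "markov_chain M X F \<longleftrightarrow>
     prob_space M \<and>
     (\<forall>s. X s \<in> measurable M (count_space UNIV)) \<and>
     (\<forall>s x k. 0 < \<P>(\<omega> in M. \<forall>t\<le>s. X t \<omega> = x t) \<longrightarrow>
        \<P>(\<omega> in M. X (Suc s) \<omega> = k \<bar> \<forall>t\<le>s. X t \<omega> = x t) = F $ x s $ k)"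

text \<open>The infimum of the empty set is \<open>\<infinity>\<close>; a nonempty set of extended naturals attains its
  infimum.\<close>

definition hitting_time :: "(nat \<Rightarrow> 'a \<Rightarrow> 'n) \<Rightarrow> 'n \<Rightarrow> 'a \<Rightarrow> enat" where
  "hitting_time X k \<omega> = (INF s\<in>{s. 0 < s \<and> X s \<omega> = k}. enat s)"

end

theory Submission
  imports Defs
begin

text \<open>Let \<open>d\<close> be the vector of the derivatives \<open>\<partial>\<pi>\<^sub>m/\<partial>F\<^sub>i\<^sub>j\<close>, so that the logarithmic derivatives are
  \<open>h\<^sub>m = d\<^sub>m / \<pi>\<^sub>m\<close>. Differentiating \<open>\<pi> G = \<pi>\<close> and \<open>\<pi> \<cdot> 1 = 1\<close> along the perturbation gives
  \<open>d F - d = - \<pi>\<^sub>i (e\<^sub>j - e\<^sub>i)\<close> and \<open>\<Sum>\<^sub>m d\<^sub>m = 0\<close> (lemma \<open>partial_pi_equations\<close>).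

  A second vector solves the same Poisson equation up to a factor. Let \<open>g\<^sub>k\<close> be the expected
  number of visits to \<open>k\<close>, at positive times, of the chain started at \<open>i\<close>, up to and including its
  first visit to \<open>{i, j}\<close>. Then \<open>q = g\<^sub>j\<close> is the probability of visiting \<open>j\<close> before returning to \<open>i\<close>.
  Let \<open>b\<close> agree with \<open>g\<close> off \<open>{i, j}\<close>, with \<open>b\<^sub>i = 1\<close> and \<open>b\<^sub>j = 0\<close>. Decomposing visits according to
  the preceding state gives \<open>b F = g\<close>, and \<open>g\<^sub>i + g\<^sub>j = 1\<close> turns this into
  \<open>b F - b = q (e\<^sub>j - e\<^sub>i)\<close>. Hence \<open>q d + \<pi>\<^sub>i b\<close> is \<open>F\<close>-invariant and, \<open>F\<close> being irreducible,
  equals \<open>c \<pi>\<close> for some \<open>c\<close>; that is, \<open>q h\<^sub>m = c - \<pi>\<^sub>i b\<^sub>m / \<pi>\<^sub>m\<close> (lemma \<open>log_derivative_formula\<close>).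

  The subtracted term lies between \<open>0\<close>, its value at \<open>j\<close>, and \<open>1\<close>, its value at \<open>i\<close>: the bound
  \<open>\<pi>\<^sub>i g\<^sub>m \<le> \<pi>\<^sub>m\<close> holds because \<open>\<pi>\<^sub>i g\<^sub>m\<close> is the probability that a stationary chain is at \<open>m\<close> now and
  made its latest earlier visit to \<open>{i, j}\<close> at \<open>i\<close>. So \<open>h\<close> is maximal at \<open>j\<close> and minimal at \<open>i\<close>, and
  the two values differ by \<open>1/q\<close>. Since \<open>\<Sum>\<^sub>m \<pi>\<^sub>m h\<^sub>m = 0\<close>, they have opposite signs (in the weak
  sense), and so the largest absolute value lies between half their difference and the whole of it.\<close>

section \<open>Uniqueness of invariant vectors\<close>

text \<open>For each \<open>l\<close> some power of \<open>F\<close> carries mass from \<open>l\<close> to \<open>m\<close>; as \<open>y\<close> is invariant under that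
  power, a positive \<open>y $ l\<close> would force \<open>y $ m\<close> to be positive.\<close>

lemma irreducible_nonneg_invariant_zero:
  fixes F :: "real^'n^'n" and y :: "real^'n"
  assumes "stochastic_matrix F" and "irreducible_matrix F"
    and inv: "y v* F = y" and nonneg: "\<And>k. 0 \<le> y $ k" and zero: "y $ m = 0"
  shows "y = 0"
proof -
  let ?P = "\<lambda>n. ((\<lambda>A. F ** A) ^^ n) (mat 1)"
  have F_nonneg: "0 \<le> F $ a $ b" for a b
    using assms(1) by (simp add: stochastic_matrix_def)
  have P_nonneg: "0 \<le> ?P n $ a $ b" for n a b
  proof (induction n arbitrary: a b)
    case 0
    then show ?case by (simp add: mat_def)
  next
    case (Suc n)
    then show ?case by (simp add: matrix_matrix_mult_def F_nonneg sum_nonneg)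
  qed
  have y_power: "y v* ?P n = y" for n
  proof (induction n)
    case 0
    then show ?case by simp
  next
    case (Suc n)
    then show ?case by (simp add: vector_matrix_mul_assoc[symmetric] inv)
  qed
  have "y $ l = 0" for l
  proof -
    obtain n where n: "0 < ?P n $ l $ m"
      using assms(2) unfolding irreducible_matrix_def by blast
    have "(\<Sum>a\<in>UNIV. ?P n $ a $ m * y $ a) = (y v* ?P n) $ m"
      by (simp add: vector_matrix_mult_def mult.commute)
    also have "\<dots> = 0"
      using zero y_power by simp
    finally have "?P n $ l $ m * y $ l = 0"
      using sum_nonneg_eq_0_iff[of UNIV "\<lambda>a. ?P n $ a $ m * y $ a"] P_nonneg nonneg by simp
    then show ?thesis using n by simp
  qed
  then show ?thesis by (simp add: vec_eq_iff)
qed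

text \<open>Subtracting from \<open>x\<close> the largest multiple of \<open>p\<close> that stays below it leaves a nonnegative
  invariant vector with a vanishing entry.\<close>

lemma irreducible_invariant_unique:
  fixes F :: "real^'n^'n" and p x :: "real^'n"
  assumes "stochastic_matrix F" and "irreducible_matrix F"
    and p: "p v* F = p" "\<And>k. 0 < p $ k" and x: "x v* F = x"
  obtains c where "x = c *\<^sub>R p"
proof -
  define c where "c = (MIN k. x $ k / p $ k)"
  have "c \<in> range (\<lambda>k. x $ k / p $ k)"
    unfolding c_def by (intro Min_in) auto
  then obtain m where m: "c = x $ m / p $ m" by auto
  have le: "c \<le> x $ k / p $ k" for k
    unfolding c_def by simp
  have "x - c *\<^sub>R p = 0"
  proof (rule irreducible_nonneg_invariant_zero[OF assms(1,2)])
    show "(x - c *\<^sub>R p) v* F = x - c *\<^sub>R p"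
      using p(1) x by (simp add: vec_eq_iff vector_matrix_mult_def algebra_simps
          sum_subtractf flip: sum_distrib_left)
    show "0 \<le> (x - c *\<^sub>R p) $ k" for k
      using le[of k] p(2)[of k] by (simp add: pos_le_divide_eq)
    show "(x - c *\<^sub>R p) $ m = 0"
      using m p(2)[of m] by simp
  qed
  then have "x = c *\<^sub>R p" by simp
  then show ?thesis by (rule that)
qed

section \<open>Taboo probabilities and their Green function\<close>

text \<open>This is the probability that the chain started at \<open>i\<close> is at \<open>k\<close> at time \<open>n + 1\<close>, having avoided
  \<open>S\<close> at the times \<open>1, \<dots>, n\<close>. The index is shifted because only positive times count, and the
  endpoint \<open>k\<close> itself may lie in \<open>S\<close>.\<close>

primrec taboo_prob :: "real^'n^'n \<Rightarrow> 'n \<Rightarrow> 'n set \<Rightarrow> nat \<Rightarrow> 'n \<Rightarrow> real" where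
  "taboo_prob F i S 0 k = F $ i $ k"
| "taboo_prob F i S (Suc n) k = (\<Sum>l\<in>-S. taboo_prob F i S n l * F $ l $ k)"

definition taboo_green :: "real^'n^'n \<Rightarrow> 'n \<Rightarrow> 'n set \<Rightarrow> 'n \<Rightarrow> real" where
  "taboo_green F i S k = (\<Sum>n. taboo_prob F i S n k)"

lemma taboo_prob_nonneg:
  assumes "stochastic_matrix F"
  shows "0 \<le> taboo_prob F i S n k"
  using assms by (induction n arbitrary: k) (auto simp: stochastic_matrix_def intro!: sum_nonneg)

lemma taboo_prob_partial_sum_Suc:
  "(\<Sum>n<Suc N. taboo_prob F i S n k)
     = F $ i $ k + (\<Sum>l\<in>-S. (\<Sum>n<N. taboo_prob F i S n l) * F $ l $ k)"
  by (subst sum.lessThan_Suc_shift) (simp add: sum_distrib_right sum.swap[of _ "-S"])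

text \<open>When \<open>p\<close> is a distribution and the chain is stationary, the left-hand side is the probability of being at \<open>k\<close> now, with the latest
  earlier visit to \<open>S\<close> being a visit to \<open>i\<close> made at most \<open>N\<close> steps ago. The invariance of \<open>p\<close> makes
  this an induction on \<open>N\<close>. The bound is uniform in \<open>N\<close>, so it also yields summability.\<close>

lemma taboo_prob_partial_sum_le:
  fixes F :: "real^'n^'n" and p :: "real^'n"
  assumes "stochastic_matrix F" and p: "p v* F = p" "\<And>k. 0 \<le> p $ k" and "i \<in> S"
  shows "p $ i * (\<Sum>n<N. taboo_prob F i S n k) \<le> p $ k"
proof (induction N arbitrary: k)
  case 0
  then show ?case using p(2) by simp
next
  case (Suc N)
  have F_nonneg: "0 \<le> F $ a $ b" for a b
    using assms(1) by (simp add: stochastic_matrix_def)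
  have "p $ i * (\<Sum>n<Suc N. taboo_prob F i S n k)
      = p $ i * F $ i $ k + (\<Sum>l\<in>-S. p $ i * (\<Sum>n<N. taboo_prob F i S n l) * F $ l $ k)"
    unfolding taboo_prob_partial_sum_Suc by (simp add: distrib_left mult.assoc sum_distrib_left[where A = "-S"])
  also have "\<dots> \<le> p $ i * F $ i $ k + (\<Sum>l\<in>-S. p $ l * F $ l $ k)"
    by (intro add_left_mono sum_mono mult_right_mono Suc F_nonneg)
  (* As i lies in S, the two contributions come from different predecessors l. *)
  also have "\<dots> = (\<Sum>l\<in>insert i (-S). p $ l * F $ l $ k)"
    using \<open>i \<in> S\<close> by simp
  also have "\<dots> \<le> (\<Sum>l\<in>UNIV. p $ l * F $ l $ k)"
    by (intro sum_mono2) (auto simp: p F_nonneg)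
  also have "\<dots> = (p v* F) $ k"
    by (simp add: vector_matrix_mult_def mult.commute)
  finally show ?case by (simp only: p(1))
qed

text \<open>The last claim says that \<open>S\<close> is almost surely visited at a positive time: in the step
  equation, summed over all \<open>k\<close>, the finite mass of the Green function off \<open>S\<close> cancels.\<close>

lemma taboo_green:
  fixes F :: "real^'n^'n" and p :: "real^'n"
  assumes "stochastic_matrix F" and p: "p v* F = p" "\<And>k. 0 < p $ k" and "i \<in> S"
  shows summable_taboo_prob: "summable (\<lambda>n. taboo_prob F i S n k)"
    and taboo_green_nonneg: "0 \<le> taboo_green F i S k"
    and taboo_green_le: "p $ i * taboo_green F i S k \<le> p $ k"
    and taboo_green_step:
      "taboo_green F i S k = F $ i $ k + (\<Sum>l\<in>-S. taboo_green F i S l * F $ l $ k)"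
    and sum_taboo_green: "(\<Sum>k\<in>S. taboo_green F i S k) = 1"
proof -
  have bound: "(\<Sum>n<N. taboo_prob F i S n k) \<le> p $ k / p $ i" for N k
    using taboo_prob_partial_sum_le[OF assms(1) p(1) less_imp_le[OF p(2)] \<open>i \<in> S\<close>, where N = N and k = k] p(2)[of i]
    by (simp add: pos_le_divide_eq mult.commute)
  have summable: "summable (\<lambda>n. taboo_prob F i S n k)" for k
    by (rule summableI_nonneg_bounded[OF taboo_prob_nonneg[OF assms(1)] bound])
  show "summable (\<lambda>n. taboo_prob F i S n k)" by (rule summable)
  show "0 \<le> taboo_green F i S k"
    unfolding taboo_green_def by (rule suminf_nonneg[OF summable taboo_prob_nonneg[OF assms(1)]])
  have "taboo_green F i S k \<le> p $ k / p $ i"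
    unfolding taboo_green_def by (rule suminf_le_const[OF summable bound])
  then show "p $ i * taboo_green F i S k \<le> p $ k"
    using p(2)[of i] by (simp add: pos_le_divide_eq mult.commute)
  have step: "taboo_green F i S k = F $ i $ k + (\<Sum>l\<in>-S. taboo_green F i S l * F $ l $ k)" for k
  proof -
    have "taboo_green F i S k = F $ i $ k + (\<Sum>n. \<Sum>l\<in>-S. taboo_prob F i S n l * F $ l $ k)"
      unfolding taboo_green_def using suminf_split_head[OF summable[of k]] by simp
    also have "(\<Sum>n. \<Sum>l\<in>-S. taboo_prob F i S n l * F $ l $ k)
        = (\<Sum>l\<in>-S. \<Sum>n. taboo_prob F i S n l * F $ l $ k)"
      by (rule suminf_sum[OF summable_mult2[OF summable]])
    finally show ?thesis
      by (simp add: taboo_green_def suminf_mult2[OF summable])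
  qed
  then show "taboo_green F i S k = F $ i $ k + (\<Sum>l\<in>-S. taboo_green F i S l * F $ l $ k)" .
  have row: "(\<Sum>k\<in>UNIV. F $ l $ k) = 1" for l
    using assms(1) by (simp add: stochastic_matrix_def)
  have "(\<Sum>k\<in>UNIV. taboo_green F i S k)
      = (\<Sum>k\<in>UNIV. F $ i $ k) + (\<Sum>k\<in>UNIV. \<Sum>l\<in>-S. taboo_green F i S l * F $ l $ k)"
    by (subst step) (simp add: sum.distrib)
  also have "\<dots> = 1 + (\<Sum>l\<in>-S. taboo_green F i S l)"
    by (subst sum.swap) (simp add: row flip: sum_distrib_left)
  finally have "(\<Sum>k\<in>UNIV. taboo_green F i S k) = 1 + (\<Sum>l\<in>-S. taboo_green F i S l)" .
  moreover have "(\<Sum>k\<in>UNIV. taboo_green F i S k)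
      = (\<Sum>k\<in>S. taboo_green F i S k) + (\<Sum>k\<in>-S. taboo_green F i S k)"
    by (subst sum.union_disjoint[symmetric]) (auto simp: Compl_partition)
  ultimately show "(\<Sum>k\<in>S. taboo_green F i S k) = 1" by simp
qed

section \<open>Solving the Poisson equation\<close>

text \<open>Both \<open>d\<close> and the vector \<open>b\<close> below solve a Poisson equation whose right-hand side is a multiple
  of \<open>e\<^sub>j - e\<^sub>i\<close>, so a combination of them is invariant and hence a multiple of \<open>p\<close>. The function
  \<open>w m\<close> is \<open>p\<^sub>i b\<^sub>m / p\<^sub>m\<close>, whose values at \<open>i\<close> and \<open>j\<close> are its extreme values.\<close>

lemma log_derivative_formula:
  fixes F :: "real^'n^'n" and p d :: "real^'n"
  assumes F: "stochastic_matrix F" "irreducible_matrix F"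
    and p: "p v* F = p" "\<And>k. 0 < p $ k"
    and "i \<noteq> j"
    and d: "d v* F + p $ i *\<^sub>R (axis j 1 - axis i 1) = d"
  obtains c w where "\<And>m. taboo_green F i {i, j} j * (d $ m / p $ m) = c - w m"
    and "\<And>m. 0 \<le> w m" and "\<And>m. w m \<le> 1" and "w i = 1" and "w j = 0"
proof -
  define g where "g = taboo_green F i {i, j}"
  (* b counts visits strictly before the first positive visit to {i, j}, including time 0. *)
  define b :: "real^'n" where "b = (\<chi> k. if k = i then 1 else if k = j then 0 else g k)"
  note green = taboo_green[OF F(1) p, of i "{i, j}", folded g_def, simplified]
  have b_F: "(b v* F) $ k = g k" for k
  proof -
    have "(b v* F) $ k = (\<Sum>l\<in>UNIV. b $ l * F $ l $ k)"
      by (simp add: vector_matrix_mult_def mult.commute)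
    also have "\<dots> = (\<Sum>l\<in>insert i (-{i, j}). b $ l * F $ l $ k)"
      by (intro sum.mono_neutral_right) (auto simp: b_def)
    also have "\<dots> = F $ i $ k + (\<Sum>l\<in>-{i, j}. g l * F $ l $ k)"
      by (auto simp: b_def intro!: sum.cong)
    also have "\<dots> = g k"
      by (rule green(4)[symmetric])
    finally show ?thesis .
  qed
  have "g i + g j = 1"
    using green(5) \<open>i \<noteq> j\<close> by simp
  then have b: "b v* F = b + g j *\<^sub>R (axis j 1 - axis i 1)"
    using \<open>i \<noteq> j\<close> by (simp add: vec_eq_iff b_F) (auto simp: b_def axis_def)
  have "(g j *\<^sub>R d + p $ i *\<^sub>R b) v* F = g j *\<^sub>R d + p $ i *\<^sub>R b"
  proof -
    have "(g j *\<^sub>R d + p $ i *\<^sub>R b) v* F = g j *\<^sub>R (d v* F) + p $ i *\<^sub>R (b v* F)"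
      by (simp add: vec_eq_iff vector_matrix_mult_def algebra_simps sum.distrib sum_distrib_left)
    also have "d v* F = d - p $ i *\<^sub>R (axis j 1 - axis i 1)"
      using d by (simp add: eq_diff_eq)
    finally show ?thesis unfolding b by (simp add: algebra_simps)
  qed
  then obtain c where c: "g j *\<^sub>R d + p $ i *\<^sub>R b = c *\<^sub>R p"
    using irreducible_invariant_unique[OF F p] by blast
  have comp: "g j * d $ m + p $ i * b $ m = c * p $ m" for m
    using arg_cong[OF c, of "\<lambda>v. v $ m"] by simp
  show ?thesis
  proof (rule that[of c "\<lambda>m. p $ i * b $ m / p $ m"])
    show "taboo_green F i {i, j} j * (d $ m / p $ m) = c - p $ i * b $ m / p $ m" for m
      using comp[of m] p(2)[of m] by (simp add: field_simps g_def)
    show "0 \<le> p $ i * b $ m / p $ m" for m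
      using p(2)[of m] p(2)[of i] green(2)[of m] by (simp add: b_def)
    show "p $ i * b $ m / p $ m \<le> 1" for m
      using p(2)[of m] p(2)[of i] p(2)[of j] green(3)[of m] by (simp add: b_def)
    show "p $ i * b $ i / p $ i = 1" "p $ i * b $ j / p $ j = 0"
      using p(2)[of i] \<open>i \<noteq> j\<close> by (simp_all add: b_def)
  qed
qed

section \<open>The derivative of the invariant distribution\<close>

text \<open>The perturbation keeps all row sums equal to \<open>1\<close> and, for small \<open>\<epsilon>\<close> of either sign, stays in the
  open set \<open>V\<close>, even where it leaves the stochastic matrices. There the invariance equation and the
  normalisation hold identically in \<open>\<epsilon>\<close> and can be differentiated at \<open>0\<close>.\<close>

lemma partial_pi_equations:
  fixes F :: "real^'n^'n"
  assumes F: "stochastic_matrix F" "irreducible_matrix F"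
    and ext: "invariant_extension V p" and "i \<noteq> j"
  defines "d \<equiv> \<chi> m. partial_pi p F i j m"
  shows "d v* F + p F $ i *\<^sub>R (axis j 1 - axis i 1) = d" and "(\<Sum>m\<in>UNIV. d $ m) = 0"
proof -
  define E :: "real^'n^'n" where
    "E = outer_product (axis i 1) (axis j 1) - outer_product (axis i 1) (axis i 1)"
  define f where "f m \<epsilon> = p (F + \<epsilon> *\<^sub>R E) $ m" for m \<epsilon>
  have "F \<in> V" and "open V"
    using F ext by (auto simp: invariant_extension_def)
  obtain D where D: "(p has_derivative D) (at F)"
    using ext \<open>F \<in> V\<close> unfolding invariant_extension_def continuously_differentiable_on_def by blast
  have line: "((\<lambda>\<epsilon>. F + \<epsilon> *\<^sub>R E) has_derivative (\<lambda>\<epsilon>. \<epsilon> *\<^sub>R E)) (at 0)"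
    by (auto intro!: derivative_eq_intros)
  have "((\<lambda>\<epsilon>. p (F + \<epsilon> *\<^sub>R E)) has_derivative (\<lambda>\<epsilon>. D (\<epsilon> *\<^sub>R E))) (at 0)"
    using has_derivative_compose[OF line, of p D] D by simp
  then have "((\<lambda>\<epsilon>. p (F + \<epsilon> *\<^sub>R E)) has_vector_derivative D E) (at 0)"
    unfolding has_vector_derivative_def
    using linear_scale[OF has_derivative_linear[OF D]] by simp
  then have "(f m has_real_derivative D E $ m) (at 0)" for m
    unfolding f_def has_real_derivative_iff_has_vector_derivative
    by (rule bounded_linear.has_vector_derivative[OF bounded_linear_vec_nth])
  moreover have "d $ m = deriv (f m) 0" for m
    by (simp add: d_def partial_pi_def f_def[abs_def] E_def)
  ultimately have f: "(f m has_real_derivative d $ m) (at 0)" for m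
    by (metis DERIV_imp_deriv)
  have E_comp: "E $ l $ m = (if l = i then axis j 1 $ m - axis i 1 $ m else 0)" for l m
    by (simp add: E_def outer_product_def axis_def)
  have "(\<Sum>m\<in>UNIV. E $ l $ m) = 0" for l
    by (cases "l = i") (simp_all add: E_comp axis_def sum_subtractf)
  then have rows: "(F + \<epsilon> *\<^sub>R E) *v 1 = 1" for \<epsilon>
    using F(1) by (simp add: vec_eq_iff matrix_vector_mult_def stochastic_matrix_def sum.distrib
        flip: sum_distrib_left)
  have "\<forall>\<^sub>F \<epsilon> in at 0. F + \<epsilon> *\<^sub>R E \<in> V"
  proof (rule topological_tendstoD[OF _ \<open>open V\<close>])
    show "((\<lambda>\<epsilon>. F + \<epsilon> *\<^sub>R E) \<longlongrightarrow> F) (at 0)"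
      by (auto intro!: tendsto_eq_intros)
    show "F \<in> V" by fact
  qed
  then have "\<forall>\<^sub>F \<epsilon> in nhds 0. F + \<epsilon> *\<^sub>R E \<in> V"
    using \<open>F \<in> V\<close> by (simp add: eventually_nhds_conv_at)
  then have ev: "\<forall>\<^sub>F \<epsilon> in nhds 0. p (F + \<epsilon> *\<^sub>R E) v* (F + \<epsilon> *\<^sub>R E) = p (F + \<epsilon> *\<^sub>R E)
      \<and> p (F + \<epsilon> *\<^sub>R E) \<bullet> 1 = 1"
    by eventually_elim (use ext rows in \<open>auto simp: invariant_extension_def\<close>)
  show "(\<Sum>m\<in>UNIV. d $ m) = 0"
  proof (rule DERIV_unique)
    show "((\<lambda>\<epsilon>. \<Sum>m\<in>UNIV. f m \<epsilon>) has_real_derivative (\<Sum>m\<in>UNIV. d $ m)) (at 0)"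
      by (intro DERIV_sum f)
    have "\<forall>\<^sub>F \<epsilon> in nhds 0. (\<Sum>m\<in>UNIV. f m \<epsilon>) = 1"
      using ev by eventually_elim (simp add: f_def inner_vec_def)
    then show "((\<lambda>\<epsilon>. \<Sum>m\<in>UNIV. f m \<epsilon>) has_real_derivative 0) (at 0)"
      using DERIV_cong_ev[of 0 0 "\<lambda>\<epsilon>. \<Sum>m\<in>UNIV. f m \<epsilon>" "\<lambda>_. 1" 0 0] by simp
  qed
  have "(d v* F) $ m + p F $ i * (axis j 1 $ m - axis i 1 $ m) = d $ m" for m
  proof (rule DERIV_unique)
    have "((\<lambda>\<epsilon>. \<Sum>l\<in>UNIV. f l \<epsilon> * (F $ l $ m + \<epsilon> * E $ l $ m)) has_real_derivative
        (\<Sum>l\<in>UNIV. d $ l * F $ l $ m + f l 0 * E $ l $ m)) (at 0)"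
      by (rule DERIV_sum) (auto intro!: derivative_eq_intros f)
    also have "(\<Sum>l\<in>UNIV. d $ l * F $ l $ m + f l 0 * E $ l $ m)
        = (d v* F) $ m + p F $ i * (axis j 1 $ m - axis i 1 $ m)"
    proof -
      have "(\<Sum>l\<in>UNIV. f l 0 * E $ l $ m)
          = (\<Sum>l\<in>UNIV. if l = i then p F $ i * (axis j 1 $ m - axis i 1 $ m) else 0)"
        by (intro sum.cong) (auto simp: f_def E_comp)
      then show ?thesis
        by (simp add: sum.distrib vector_matrix_mult_def mult.commute)
    qed
    finally show "((\<lambda>\<epsilon>. \<Sum>l\<in>UNIV. f l \<epsilon> * (F $ l $ m + \<epsilon> * E $ l $ m)) has_real_derivative
        (d v* F) $ m + p F $ i * (axis j 1 $ m - axis i 1 $ m)) (at 0)" .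
    have "\<forall>\<^sub>F \<epsilon> in nhds 0. (\<Sum>l\<in>UNIV. f l \<epsilon> * (F $ l $ m + \<epsilon> * E $ l $ m)) = f m \<epsilon>"
      using ev by eventually_elim
        (auto simp: f_def vec_eq_iff vector_matrix_mult_def mult.commute)
    then show "((\<lambda>\<epsilon>. \<Sum>l\<in>UNIV. f l \<epsilon> * (F $ l $ m + \<epsilon> * E $ l $ m)) has_real_derivative d $ m) (at 0)"
      using f[of m] DERIV_cong_ev[of 0 0 "\<lambda>\<epsilon>. \<Sum>l\<in>UNIV. f l \<epsilon> * (F $ l $ m + \<epsilon> * E $ l $ m)" "f m"
          "d $ m" "d $ m"] by simp
  qed
  then show "d v* F + p F $ i *\<^sub>R (axis j 1 - axis i 1) = d"
    by (simp add: vec_eq_iff)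
qed

section \<open>Path probabilities of the Markov chain\<close>

text \<open>The defining property of the chain conditions on one exact history. It extends to any event
  \<open>Q\<close> of the past because finitely many histories up to time \<open>s\<close> exist; restricting the path to
  \<open>{..s}\<close> picks one representative of each, and makes \<open>Q\<close> depend on the past only.\<close>

lemma markov_chain_history_step:
  fixes X :: "nat \<Rightarrow> 'a \<Rightarrow> 'n::finite"
  assumes "markov_chain M X F"
  shows "\<P>(\<omega> in M. Q (restrict (\<lambda>t. X t \<omega>) {..s}) \<and> X s \<omega> = l \<and> X (Suc s) \<omega> = k)
    = \<P>(\<omega> in M. Q (restrict (\<lambda>t. X t \<omega>) {..s}) \<and> X s \<omega> = l) * F $ l $ k"
proof -
  interpret prob_space M
    using assms by (simp add: markov_chain_def)
  have X[measurable]: "X t \<in> measurable M (count_space UNIV)" for t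
    using assms by (simp add: markov_chain_def)
  define B where "B = {x \<in> {..s} \<rightarrow>\<^sub>E UNIV. Q x \<and> x s = l}"
  have "finite B"
    unfolding B_def by (rule finite_subset[OF _ finite_PiE[of "{..s}" "\<lambda>_. UNIV"]]) auto
  define C where "C x = {\<omega> \<in> space M. \<forall>t\<le>s. X t \<omega> = x t}" for x
  have C_sets[measurable]: "C x \<in> sets M" for x
    unfolding C_def by measurable
  have K_sets[measurable]: "{\<omega> \<in> space M. X (Suc s) \<omega> = k} \<in> sets M"
    by measurable
  have step: "prob (C x \<inter> {\<omega> \<in> space M. X (Suc s) \<omega> = k}) = prob (C x) * F $ x s $ k" for x
  proof (cases "prob (C x) = 0")
    case True
    then show ?thesis
      using finite_measure_mono[of "C x \<inter> {\<omega> \<in> space M. X (Suc s) \<omega> = k}" "C x"] measure_nonneg[of M]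
      by (simp add: antisym)
  next
    case False
    then have "0 < prob (C x)" by (simp add: zero_less_measure_iff)
    then have "\<P>(\<omega> in M. X (Suc s) \<omega> = k \<bar> \<forall>t\<le>s. X t \<omega> = x t) = F $ x s $ k"
      using assms unfolding markov_chain_def C_def by blast
    moreover have "{\<omega> \<in> space M. X (Suc s) \<omega> = k \<and> (\<forall>t\<le>s. X t \<omega> = x t)}
        = C x \<inter> {\<omega> \<in> space M. X (Suc s) \<omega> = k}"
      by (auto simp: C_def)
    ultimately show ?thesis
      using False unfolding cond_prob_def C_def[symmetric] by (simp add: field_simps)
  qed
  have disj: "disjoint_family_on C B"
    unfolding disjoint_family_on_def
  proof (intro ballI impI)
    fix x y assume "x \<in> B" "y \<in> B" "x \<noteq> y"
    then obtain t where "t \<le> s" "x t \<noteq> y t"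
      unfolding B_def by (metis (no_types, lifting) PiE_ext atMost_iff mem_Collect_eq)
    then show "C x \<inter> C y = {}"
      by (auto simp: C_def)
  qed
  then have disj': "disjoint_family_on (\<lambda>x. C x \<inter> {\<omega> \<in> space M. X (Suc s) \<omega> = k}) B"
    by (auto simp: disjoint_family_on_def)
  have history: "(Q (restrict (\<lambda>t. X t \<omega>) {..s}) \<and> X s \<omega> = l) \<longleftrightarrow> (\<exists>x\<in>B. \<forall>t\<le>s. X t \<omega> = x t)" for \<omega>
  proof
    assume "Q (restrict (\<lambda>t. X t \<omega>) {..s}) \<and> X s \<omega> = l"
    then show "\<exists>x\<in>B. \<forall>t\<le>s. X t \<omega> = x t"
      by (intro bexI[of _ "restrict (\<lambda>t. X t \<omega>) {..s}"]) (auto simp: B_def)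
  next
    assume "\<exists>x\<in>B. \<forall>t\<le>s. X t \<omega> = x t"
    then obtain x where x: "x \<in> B" "\<forall>t\<le>s. X t \<omega> = x t" by blast
    then have "restrict (\<lambda>t. X t \<omega>) {..s} = x"
      by (intro ext) (auto simp: B_def PiE_def extensional_def)
    then show "Q (restrict (\<lambda>t. X t \<omega>) {..s}) \<and> X s \<omega> = l"
      using x by (auto simp: B_def)
  qed
  have "{\<omega> \<in> space M. Q (restrict (\<lambda>t. X t \<omega>) {..s}) \<and> X s \<omega> = l \<and> X (Suc s) \<omega> = k}
      = (\<Union>x\<in>B. C x \<inter> {\<omega> \<in> space M. X (Suc s) \<omega> = k})"
    unfolding conj_assoc[symmetric] history by (auto simp: C_def)
  then have "\<P>(\<omega> in M. Q (restrict (\<lambda>t. X t \<omega>) {..s}) \<and> X s \<omega> = l \<and> X (Suc s) \<omega> = k)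
      = prob (\<Union>x\<in>B. C x \<inter> {\<omega> \<in> space M. X (Suc s) \<omega> = k})"
    by (rule arg_cong)
  also have "\<dots> = (\<Sum>x\<in>B. prob (C x \<inter> {\<omega> \<in> space M. X (Suc s) \<omega> = k}))"
    by (rule finite_measure_finite_Union[OF \<open>finite B\<close> _ disj']) auto
  also have "\<dots> = (\<Sum>x\<in>B. prob (C x)) * F $ l $ k"
    unfolding sum_distrib_right by (rule sum.cong) (auto simp: step B_def)
  also have "(\<Sum>x\<in>B. prob (C x)) = prob (\<Union>x\<in>B. C x)"
    by (simp add: finite_measure_finite_Union[OF \<open>finite B\<close> _ disj] image_subset_iff)
  also have "(\<Union>x\<in>B. C x) = {\<omega> \<in> space M. Q (restrict (\<lambda>t. X t \<omega>) {..s}) \<and> X s \<omega> = l}"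
    unfolding history by (auto simp: C_def)
  finally show ?thesis .
qed

lemma prob_taboo_path:
  fixes X :: "nat \<Rightarrow> 'a \<Rightarrow> 'n::finite"
  assumes "markov_chain M X F"
  shows "\<P>(\<omega> in M. X 0 \<omega> = i \<and> (\<forall>t\<in>{1..n}. X t \<omega> \<notin> S) \<and> X (Suc n) \<omega> = k)
    = \<P>(\<omega> in M. X 0 \<omega> = i) * taboo_prob F i S n k"
proof (induction n arbitrary: k)
  case 0
  show ?case
    using markov_chain_history_step[OF assms, of "\<lambda>_. True" 0 i k] by simp
next
  case (Suc n)
  interpret prob_space M
    using assms by (simp add: markov_chain_def)
  have X[measurable]: "X t \<in> measurable M (count_space UNIV)" for t
    using assms by (simp add: markov_chain_def)
  define A where "A l = {\<omega> \<in> space M. X 0 \<omega> = i \<and> (\<forall>t\<in>{1..n}. X t \<omega> \<notin> S) \<and> X (Suc n) \<omega> = l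
    \<and> X (Suc (Suc n)) \<omega> = k}" for l
  have A_sets: "A l \<in> sets M" for l
    unfolding A_def by measurable
  have A: "prob (A l) = \<P>(\<omega> in M. X 0 \<omega> = i) * taboo_prob F i S n l * F $ l $ k" for l
    using markov_chain_history_step[OF assms,
        of "\<lambda>x. x 0 = i \<and> (\<forall>t\<in>{1..n}. x t \<notin> S)" "Suc n" l k]
    by (simp add: A_def Suc[symmetric])
  have "{\<omega> \<in> space M. X 0 \<omega> = i \<and> (\<forall>t\<in>{1..Suc n}. X t \<omega> \<notin> S) \<and> X (Suc (Suc n)) \<omega> = k}
      = (\<Union>l\<in>-S. A l)"
    by (auto simp: A_def atLeastAtMostSuc_conv)
  moreover have "prob (\<Union>l\<in>-S. A l) = (\<Sum>l\<in>-S. prob (A l))"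
    by (rule finite_measure_finite_Union) (auto simp: A_sets disjoint_family_on_def A_def)
  ultimately show ?case
    by (simp add: A sum_distrib_left mult.assoc)
qed

section \<open>The hitting probability as a Green function\<close>

text \<open>The witness \<open>Suc n\<close> is the first visit to \<open>j\<close>, so that \<open>j\<close> is avoided before it as well; this
  makes the events for different \<open>n\<close> disjoint.\<close>

lemma hitting_time_less_iff:
  "hitting_time X j \<omega> < hitting_time X i \<omega>
     \<longleftrightarrow> (\<exists>n. (\<forall>t\<in>{1..n}. X t \<omega> \<notin> {i, j}) \<and> X (Suc n) \<omega> = j \<and> i \<noteq> j)"
proof -
  (* Comparing with the successor of s turns the strict bound into a bound on an infimum. *)
  have less_i: "enat s < hitting_time X i \<omega> \<longleftrightarrow> (\<forall>t\<in>{1..s}. X t \<omega> \<noteq> i)" for s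
    unfolding hitting_time_def Suc_ile_eq[symmetric] le_INF_iff
    by (auto simp: Suc_le_eq)
  have "hitting_time X j \<omega> < hitting_time X i \<omega>
      \<longleftrightarrow> (\<exists>s>0. X s \<omega> = j \<and> (\<forall>t\<in>{1..s}. X t \<omega> \<noteq> i))"
    unfolding less_i[symmetric] hitting_time_def[of X j] INF_less_iff by auto
  also have "\<dots> \<longleftrightarrow> (\<exists>n. (\<forall>t\<in>{1..n}. X t \<omega> \<notin> {i, j}) \<and> X (Suc n) \<omega> = j \<and> i \<noteq> j)"
  proof
    assume ex: "\<exists>s>0. X s \<omega> = j \<and> (\<forall>t\<in>{1..s}. X t \<omega> \<noteq> i)"
    define s where "s = (LEAST s. 0 < s \<and> X s \<omega> = j \<and> (\<forall>t\<in>{1..s}. X t \<omega> \<noteq> i))"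
    have s: "0 < s \<and> X s \<omega> = j \<and> (\<forall>t\<in>{1..s}. X t \<omega> \<noteq> i)"
      unfolding s_def by (rule LeastI_ex) (use ex in blast)
    then obtain n where n: "s = Suc n" by (cases s) auto
    have "X t \<omega> \<noteq> j" if "t \<in> {1..n}" for t
      using not_less_Least[of t "\<lambda>s. 0 < s \<and> X s \<omega> = j \<and> (\<forall>t\<in>{1..s}. X t \<omega> \<noteq> i)"] that s
      unfolding s_def[symmetric] n by auto
    then show "\<exists>n. (\<forall>t\<in>{1..n}. X t \<omega> \<notin> {i, j}) \<and> X (Suc n) \<omega> = j \<and> i \<noteq> j"
      using s by (intro exI[of _ n]) (auto simp: n)
  next
    assume "\<exists>n. (\<forall>t\<in>{1..n}. X t \<omega> \<notin> {i, j}) \<and> X (Suc n) \<omega> = j \<and> i \<noteq> j"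
    then obtain n where "\<forall>t\<in>{1..n}. X t \<omega> \<notin> {i, j}" "X (Suc n) \<omega> = j" "i \<noteq> j" by blast
    then show "\<exists>s>0. X s \<omega> = j \<and> (\<forall>t\<in>{1..s}. X t \<omega> \<noteq> i)"
      by (intro exI[of _ "Suc n"]) (auto simp: atLeastAtMostSuc_conv)
  qed
  finally show ?thesis .
qed

lemma cond_prob_hitting_time_less:
  fixes X :: "nat \<Rightarrow> 'a \<Rightarrow> 'n::finite"
  assumes "markov_chain M X F" and "i \<noteq> j" and pos: "0 < \<P>(\<omega> in M. X 0 \<omega> = i)"
    and summable: "summable (\<lambda>n. taboo_prob F i {i, j} n j)"
  shows "\<P>(\<omega> in M. hitting_time X j \<omega> < hitting_time X i \<omega> \<bar> X 0 \<omega> = i) = taboo_green F i {i, j} j"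
proof -
  interpret prob_space M
    using assms(1) by (simp add: markov_chain_def)
  have X[measurable]: "X t \<in> measurable M (count_space UNIV)" for t
    using assms(1) by (simp add: markov_chain_def)
  define A where "A n = {\<omega> \<in> space M. X 0 \<omega> = i \<and> (\<forall>t\<in>{1..n}. X t \<omega> \<notin> {i, j}) \<and> X (Suc n) \<omega> = j}" for n
  have "range A \<subseteq> sets M"
    unfolding A_def by (auto; measurable)
  moreover have "disjoint_family A"
    unfolding disjoint_family_on_def
  proof (intro ballI impI)
    have "A m \<inter> A n = {}" if "m < n" for m n
    proof -
      have "Suc m \<in> {1..n}" using that by simp
      then show ?thesis by (fastforce simp: A_def)
    qed
    then show "A m \<inter> A n = {}" if "m \<noteq> n" for m n
      using that by (metis Int_commute nat_neq_iff)
  qed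
  ultimately have "(\<lambda>n. prob (A n)) sums prob (\<Union>n. A n)"
    by (rule finite_measure_UNION)
  moreover have "prob (A n) = \<P>(\<omega> in M. X 0 \<omega> = i) * taboo_prob F i {i, j} n j" for n
    unfolding A_def by (rule prob_taboo_path[OF assms(1)])
  ultimately have "(\<lambda>n. \<P>(\<omega> in M. X 0 \<omega> = i) * taboo_prob F i {i, j} n j) sums prob (\<Union>n. A n)"
    by simp
  then have "prob (\<Union>n. A n) = \<P>(\<omega> in M. X 0 \<omega> = i) * taboo_green F i {i, j} j"
    unfolding taboo_green_def using sums_mult[OF summable_sums[OF summable]] sums_unique2 by blast
  moreover have "{\<omega> \<in> space M. hitting_time X j \<omega> < hitting_time X i \<omega> \<and> X 0 \<omega> = i} = (\<Union>n. A n)"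
    using \<open>i \<noteq> j\<close> unfolding hitting_time_less_iff A_def by auto
  ultimately show ?thesis
    using pos by (simp add: cond_prob_def)
qed

section \<open>Sensitivity of the invariant distribution\<close>

theorem theorem2:
  fixes F :: "real^'n^'n"
    and V :: "(real^'n^'n) set"
    and pbar :: "real^'n^'n \<Rightarrow> real^'n"
    and M :: "'a measure"
    and X :: "nat \<Rightarrow> 'a \<Rightarrow> 'n"
    and i j :: 'n
  assumes "stochastic_matrix F"
    and "irreducible_matrix F"
    and "invariant_extension V pbar"
    and "markov_chain M X F"
    and "i \<noteq> j"
    and "0 < \<P>(\<omega> in M. X 0 \<omega> = i)"
  shows "1 / 2 * (1 / \<P>(\<omega> in M. hitting_time X j \<omega> < hitting_time X i \<omega> \<bar> X 0 \<omega> = i))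
           \<le> (MAX m. \<bar>partial_log_pi pbar F i j m\<bar>)
       \<and> (MAX m. \<bar>partial_log_pi pbar F i j m\<bar>)
           \<le> 1 / \<P>(\<omega> in M. hitting_time X j \<omega> < hitting_time X i \<omega> \<bar> X 0 \<omega> = i)
       \<and> (MAX m. partial_log_pi pbar F i j m) - (MIN m. partial_log_pi pbar F i j m)
           = 1 / \<P>(\<omega> in M. hitting_time X j \<omega> < hitting_time X i \<omega> \<bar> X 0 \<omega> = i)"
proof -
  define p where "p = pbar F"
  define d where "d = (\<chi> m. partial_pi pbar F i j m)"
  define q where "q = taboo_green F i {i, j} j"
  define h where "h m = d $ m / p $ m" for m
  have ext: "F \<in> V" "p = invariant_distribution F" "\<And>m. 0 < p $ m"
    and "F *v 1 = 1 \<longrightarrow> p v* F = p"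
    using assms(1-3) unfolding invariant_extension_def p_def by blast+
  moreover have "F *v 1 = 1"
    using assms(1) by (simp add: vec_eq_iff matrix_vector_mult_def stochastic_matrix_def)
  ultimately have p: "p v* F = p" "\<And>m. 0 < p $ m" by simp_all
  have d: "d v* F + p $ i *\<^sub>R (axis j 1 - axis i 1) = d" "(\<Sum>m\<in>UNIV. d $ m) = 0"
    using partial_pi_equations[OF assms(1-3,5)] unfolding d_def p_def by simp_all
  have h: "partial_log_pi pbar F i j = h"
    by (simp add: fun_eq_iff partial_log_pi_def h_def d_def ext(2)[symmetric])
  have P: "\<P>(\<omega> in M. hitting_time X j \<omega> < hitting_time X i \<omega> \<bar> X 0 \<omega> = i) = q"
    unfolding q_def using assms(4-6) summable_taboo_prob[OF assms(1) p]
    by (intro cond_prob_hitting_time_less) simp_all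
  obtain c w where hw: "\<And>m. q * h m = c - w m"
    and w: "\<And>m. 0 \<le> w m" "\<And>m. w m \<le> 1" "w i = 1" "w j = 0"
    using log_derivative_formula[OF assms(1,2) p assms(5) d(1)] unfolding q_def h_def by blast
  have diff: "q * (h j - h i) = 1"
    using hw[of i] hw[of j] w by (simp add: right_diff_distrib)
  have "0 \<le> q"
    unfolding q_def by (rule taboo_green_nonneg[OF assms(1) p]) simp
  then have "0 < q"
    using diff by (cases "q = 0") auto
  have upper: "h m \<le> h j" and lower: "h i \<le> h m" for m
  proof -
    have "q * h m \<le> q * h j" "q * h i \<le> q * h m"
      using hw[of m] hw[of i] hw[of j] w(1,2)[of m] w(3,4) by simp_all
    then show "h m \<le> h j" "h i \<le> h m"
      using \<open>0 < q\<close> by simp_all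
  qed
  have Max: "(MAX m. h m) = h j" and Min: "(MIN m. h m) = h i"
    using upper lower by (auto intro!: Max_eqI Min_eqI)
  have gap: "h j - h i = 1 / q"
    using diff \<open>0 < q\<close> by (simp add: field_simps)
  have "(\<Sum>m\<in>UNIV. p $ m * h m) = 0"
    using d(2) p(2) by (simp add: h_def less_imp_neq[THEN not_sym])
  then have sign: "h i \<le> 0" "0 \<le> h j"
  proof -
    have "(\<Sum>m\<in>UNIV. p $ m * h i) \<le> (\<Sum>m\<in>UNIV. p $ m * h m)"
      "(\<Sum>m\<in>UNIV. p $ m * h m) \<le> (\<Sum>m\<in>UNIV. p $ m * h j)"
      using upper lower p(2) by (intro sum_mono mult_left_mono; simp add: less_imp_le)+
    moreover have "0 < (\<Sum>m\<in>UNIV. p $ m)"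
      by (rule sum_pos) (simp_all add: p(2))
    ultimately show "h i \<le> 0" "0 \<le> h j"
      using \<open>(\<Sum>m\<in>UNIV. p $ m * h m) = 0\<close>
      by (simp_all add: mult_le_0_iff zero_le_mult_iff flip: sum_distrib_right)
  qed
  have abs_le: "(MAX m. \<bar>h m\<bar>) \<le> 1 / q"
  proof -
    have "\<bar>h m\<bar> \<le> 1 / q" for m
      using upper[of m] lower[of m] sign gap by linarith
    then show ?thesis by (auto intro!: Max.boundedI)
  qed
  have "\<bar>h i\<bar> \<le> (MAX m. \<bar>h m\<bar>)" "\<bar>h j\<bar> \<le> (MAX m. \<bar>h m\<bar>)"
    by simp_all
  then have "1 / 2 * (1 / q) \<le> (MAX m. \<bar>h m\<bar>)"
    using gap sign by linarith
  then show ?thesis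
    unfolding P h Max Min using abs_le gap by simp
qed

end
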